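(* Let $K\in\mathcal{K}^n$ and let $\lambda_i=\lambda_i(K)$, $i=1,\dots,n$, be its successive minima. Then $$\mathrm{G}(K)\leq \mathrm{vol}(K)\prod_{i=1}^n\left(1+\frac{n\lambda_i}{2}\right).$$ Moreover, if $\lambda_n\leq \frac{2}{n}$, then $$\mathrm{G}(\mathrm{int}\, K)\geq \mathrm{vol}(K)\prod_{i=1}^n\left(1-\frac{n\lambda_i}{2}\right).$$
   Context: $\mathcal{K}^n$ is the class of all compact convex sets in $\mathbb{R}^n$ with non-empty interior. For $A\subseteq\mathbb{R}^n$, $\mathrm{G}(A)=|A\cap\mathbb{Z}^n|$ is the number of integer points in $A$; $\mathrm{vol}$ is the $n$-dimensional volume and $\mathrm{int}$ denotes the interior. For $K\in\mathcal{K}^n$ with $K=-K$, the $i$-th successive minimum is $\lambda_i(K)=\min\{\lambda>0:\dim(\lambda K\cap\mathbb{Z}^n)\geq i\}$, $1\le i\le n$, where $\dim$ of a set of lattice points in the symmetric body is the dimension of its linear span. For general $K\in\mathcal{K}^n$ one puts $\lambda_i(K)=\lambda_i(\mathrm{cs}(K))$, where $\mathrm{cs}(K)=\frac12(K-K)$. *)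

theory Defs
  imports "HOL-Analysis.Analysis"
begin

definition convex_bodies :: "(real ^ 'n) set set" where
  "convex_bodies = {K. compact K \<and> convex K \<and> interior K \<noteq> {}}"

definition integer_lattice :: "(real ^ 'n) set" where
  "integer_lattice = {x. \<forall>i. x $ i \<in> \<int>}"

definition lattice_count :: "(real ^ 'n) set \<Rightarrow> nat" where
  "lattice_count A = card (A \<inter> integer_lattice)"

(* The central symmetral (K - K) / 2; the difference is the Minkowski difference. *)
definition central_symmetral :: "(real ^ 'n) set \<Rightarrow> (real ^ 'n) set" where
  "central_symmetral K = (\<lambda>z. (1 / 2) *\<^sub>R z) ` {x - y |x y. x \<in> K \<and> y \<in> K}"

(* Intended for S = - S and 1 \<le> i \<le> n, where the minimum is attained for a convex body S. *)
definition symmetric_successive_minimum :: "(real ^ 'n) set \<Rightarrow> nat \<Rightarrow> real" where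
  "symmetric_successive_minimum S i =
     (LEAST c. 0 < c \<and> i \<le> dim ((\<lambda>x. c *\<^sub>R x) ` S \<inter> integer_lattice))"

(* No conflict with the previous definition: a convex set K with K = - K is its own
   central symmetral. *)
definition successive_minimum :: "(real ^ 'n) set \<Rightarrow> nat \<Rightarrow> real" where
  "successive_minimum K i = symmetric_successive_minimum (central_symmetral K) i"

end

theory Submission
  imports Defs "HOL-Real_Asymp.Real_Asymp"
begin

text \<open>
  Put \<open>t\<^sub>i = \<lambda>\<^sub>i / 2\<close>. The successive minima provide linearly independent lattice vectors
  \<open>z\<^sub>i = t\<^sub>i (x\<^sub>i - y\<^sub>i)\<close> with \<open>x\<^sub>i, y\<^sub>i \<in> K\<close>; the parallelepiped \<open>P\<close> spanned by the \<open>z\<^sub>i\<close> meets every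
  coset of the integer lattice.

  Upper bound: \<open>G(K) \<le> vol(K + P)\<close>. The sum is formed one edge of \<open>P\<close> at a time. If a body contains
  \<open>x\<close> and \<open>y\<close> and \<open>z = t (x - y)\<close>, then adding the segment \<open>[0, z/N]\<close> stays inside a translate of
  the body dilated by \<open>1 + t/N\<close>. Since the added volume is subadditive in the length of the segment,
  adding \<open>[0, z]\<close> adds at most \<open>N ((1 + t/N)\<^sup>n - 1)\<close> times the volume, and this tends to \<open>n t\<close>.

  Lower bound: with \<open>s = \<Sum> t\<^sub>i\<close>, convexity gives a translate of \<open>(1 - s) int K\<close> whose sum with \<open>P\<close>
  lies in \<open>int K\<close>, so \<open>G(int K) \<ge> (1 - s)\<^sup>n vol(K)\<close>; as \<open>1 - s\<close> is the mean of the numbers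
  \<open>1 - n t\<^sub>i\<close>, the AM-GM inequality concludes.
\<close>

section \<open>Elementary properties of the integer lattice\<close>

lemma integer_lattice_0: "0 \<in> integer_lattice"
  by (simp add: integer_lattice_def)

lemma integer_lattice_add:
  "x \<in> integer_lattice \<Longrightarrow> y \<in> integer_lattice \<Longrightarrow> x + y \<in> integer_lattice"
  by (simp add: integer_lattice_def)

lemma integer_lattice_int_scale:
  "x \<in> integer_lattice \<Longrightarrow> real_of_int k *\<^sub>R x \<in> integer_lattice"
  by (simp add: integer_lattice_def)

lemma integer_lattice_sum:
  "(\<And>i. i \<in> I \<Longrightarrow> f i \<in> integer_lattice) \<Longrightarrow> sum f I \<in> integer_lattice"
  by (induction I rule: infinite_finite_induct) (simp_all add: integer_lattice_0 integer_lattice_add)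

text \<open>Justifies the countable decomposition of space into cells and the exchange of sum and
  integral below.\<close>

lemma countable_integer_lattice: "countable (integer_lattice :: (real ^ 'n) set)"
proof -
  have "(integer_lattice :: (real ^ 'n) set) \<subseteq> vec_lambda ` (Pi\<^sub>E UNIV (\<lambda>_. \<int>))"
  proof
    fix x :: "real ^ 'n"
    assume "x \<in> integer_lattice"
    then have "vec_nth x \<in> Pi\<^sub>E UNIV (\<lambda>_. \<int>)"
      by (auto simp: integer_lattice_def)
    then show "x \<in> vec_lambda ` (Pi\<^sub>E UNIV (\<lambda>_. \<int>))"
      by (intro image_eqI[of _ _ "vec_nth x"]) (simp_all only: vec_nth_inverse)
  qed
  moreover have "countable (Pi\<^sub>E (UNIV :: 'n set) (\<lambda>_. \<int> :: real set))"
    by (intro countable_PiE) (auto simp: countable_int)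
  ultimately show ?thesis
    by (meson countable_image countable_subset)
qed

lemma finite_bounded_Int_integer_lattice:
  fixes B :: "(real ^ 'n) set"
  assumes "bounded B"
  shows "finite (B \<inter> integer_lattice)"
proof -
  obtain R where R: "\<And>x. x \<in> B \<Longrightarrow> norm x \<le> R"
    using assms by (auto simp: bounded_iff)
  let ?F = "{k :: real. k \<in> \<int> \<and> \<bar>k\<bar> \<le> R}"
  have "B \<inter> integer_lattice \<subseteq> vec_lambda ` (Pi\<^sub>E UNIV (\<lambda>_. ?F))"
  proof
    fix x assume x: "x \<in> B \<inter> integer_lattice"
    have "\<bar>x $ i\<bar> \<le> R" for i
      using x R[of x] component_le_norm_cart[of x i] by simp
    with x have "vec_nth x \<in> Pi\<^sub>E UNIV (\<lambda>_. ?F)"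
      by (intro PiE_I) (simp_all add: integer_lattice_def)
    then show "x \<in> vec_lambda ` (Pi\<^sub>E UNIV (\<lambda>_. ?F))"
      by (intro image_eqI[of _ _ "vec_nth x"]) (simp_all only: vec_nth_inverse)
  qed
  moreover have "finite (Pi\<^sub>E (UNIV :: 'n set) (\<lambda>_. ?F))"
    by (intro finite_PiE) (auto simp: finite_abs_int_segment)
  ultimately show ?thesis
    by (meson finite_imageI finite_subset)
qed

subsection \<open>Counting lattice translates\<close>

text \<open>Half-open, so that its integer translates tile the space without overlap.\<close>

definition unit_cell :: "(real ^ 'n) set" where
  "unit_cell = {x. \<forall>i. 0 \<le> x $ i \<and> x $ i < 1}"

lemma unit_cell_borel [measurable]: "unit_cell \<in> sets borel"
  unfolding unit_cell_def by measurable

text \<open>The cell lies between the open and the closed unit box, both of volume 1.\<close>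

lemma emeasure_unit_cell: "emeasure lborel (unit_cell :: (real ^ 'n) set) = 1"
proof (rule antisym)
  have "emeasure lborel (unit_cell :: (real ^ 'n) set) \<le> emeasure lborel (cbox 0 (One :: real ^ 'n))"
  proof (rule emeasure_mono)
    show "(unit_cell :: (real ^ 'n) set) \<subseteq> cbox 0 One"
    proof
      fix x :: "real ^ 'n" assume x: "x \<in> unit_cell"
      have "0 \<le> x \<bullet> b \<and> x \<bullet> b \<le> 1" if b: "b \<in> Basis" for b
      proof -
        obtain i where "b = axis i 1" using b by (auto simp: Basis_vec_def)
        then show ?thesis using x by (auto simp: unit_cell_def inner_axis less_imp_le)
      qed
      then show "x \<in> cbox 0 One" by (simp add: mem_box inner_sum_left_Basis)
    qed
  qed simp
  also have "\<dots> = 1"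
    by (subst emeasure_lborel_cbox) (auto simp: inner_sum_left_Basis)
  finally show "emeasure lborel (unit_cell :: (real ^ 'n) set) \<le> 1" .
  have "1 = emeasure lborel (box 0 (One :: real ^ 'n))"
    by (subst emeasure_lborel_box) (auto simp: inner_sum_left_Basis)
  also have "\<dots> \<le> emeasure lborel (unit_cell :: (real ^ 'n) set)"
  proof (rule emeasure_mono)
    show "box 0 One \<subseteq> (unit_cell :: (real ^ 'n) set)"
    proof
      fix x :: "real ^ 'n" assume x: "x \<in> box 0 One"
      have "0 < x $ i \<and> x $ i < 1" for i
        using x[unfolded mem_box, THEN bspec, of "axis i 1"] inner_axis[of x i 1]
          inner_sum_left_Basis[of "axis i (1 :: real)" "\<lambda>_. 1"]
        by simp
      then show "x \<in> unit_cell" by (auto simp: unit_cell_def less_imp_le)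
    qed
  qed simp
  finally show "1 \<le> emeasure lborel (unit_cell :: (real ^ 'n) set)" .
qed

text \<open>Cut \<open>M\<close> along the integer translates of the unit cell and shift every piece
  back into the cell: the volume becomes the integral over \<open>x\<close> of the number of points
  of \<open>M\<close> in the coset of \<open>x\<close>. Counting by \<open>count_space\<close>
  allows the value infinity. Both bounds rest on this formula.\<close>

lemma emeasure_periodization:
  fixes M :: "(real ^ 'n) set"
  assumes [measurable]: "M \<in> sets borel"
  shows "emeasure lborel M =
    (\<integral>\<^sup>+x. indicator unit_cell x *
      emeasure (count_space integer_lattice) {u \<in> integer_lattice. x + u \<in> M} \<partial>lborel)"
proof -
  let ?Z = "integer_lattice :: (real ^ 'n) set"
  define X where "X u = M \<inter> {x. x - u \<in> unit_cell}" for u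
  have X [measurable]: "X u \<in> sets borel" for u
    unfolding X_def by measurable
  have "\<exists>u\<in>?Z. x - u \<in> unit_cell" for x
  proof
    show "(\<chi> i. real_of_int \<lfloor>x $ i\<rfloor>) \<in> ?Z"
      by (simp add: integer_lattice_def)
    show "x - (\<chi> i. real_of_int \<lfloor>x $ i\<rfloor>) \<in> unit_cell"
      by (auto simp: unit_cell_def) linarith
  qed
  then have M: "M = (\<Union>u\<in>?Z. X u)"
    by (auto simp: X_def)
  have disj: "disjoint_family_on X ?Z"
  proof (unfold disjoint_family_on_def, intro ballI impI)
    fix u v assume uv: "u \<in> ?Z" "v \<in> ?Z" "u \<noteq> v"
    show "X u \<inter> X v = {}"
    proof (rule ccontr)
      assume "X u \<inter> X v \<noteq> {}"
      then obtain x where x: "x - u \<in> unit_cell" "x - v \<in> unit_cell"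
        by (auto simp: X_def)
      \<comment> \<open>Two integers, both in the half-open interval of length 1 ending at
        \<open>x $ i\<close>, coincide.\<close>
      have "u $ i = v $ i" for i
      proof -
        obtain a b where "u $ i = of_int a" "v $ i = of_int b"
          using uv by (auto simp: integer_lattice_def elim!: Ints_cases) (metis Ints_cases)
        moreover have "0 \<le> x $ i - u $ i" "x $ i - u $ i < 1" "0 \<le> x $ i - v $ i" "x $ i - v $ i < 1"
          using x by (auto simp: unit_cell_def)
        ultimately have "u $ i = of_int a" "v $ i = of_int b"
          "real_of_int a < real_of_int b + 1" "real_of_int b < real_of_int a + 1"
          by linarith+
        moreover from this(3,4) have "a = b" by linarith
        ultimately show ?thesis by simp
      qed
      with uv show False by (simp add: vec_eq_iff)
    qed
  qed
  have Xu: "emeasure lborel (X u) = (\<integral>\<^sup>+x. indicator unit_cell x * indicator M (x + u) \<partial>lborel)" for u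
  proof -
    have "emeasure lborel (X u) = emeasure (distr lborel borel ((+) u)) (X u)"
      by (simp add: lborel_distr_plus)
    also have "\<dots> = emeasure lborel ((+) u -` X u)"
      by (subst emeasure_distr) auto
    also have "\<dots> = (\<integral>\<^sup>+x. indicator ((+) u -` X u) x \<partial>lborel)"
    proof (subst nn_integral_indicator)
      have "(+) u -` X u \<inter> space borel \<in> sets borel"
        by measurable
      then show "(+) u -` X u \<in> sets lborel" by simp
    qed simp
    also have "\<dots> = (\<integral>\<^sup>+x. indicator unit_cell x * indicator M (x + u) \<partial>lborel)"
      by (intro nn_integral_cong) (auto simp: X_def indicator_def add.commute)
    finally show ?thesis .
  qed
  have "emeasure lborel M = (\<integral>\<^sup>+u. emeasure lborel (X u) \<partial>count_space ?Z)"
    by (subst M, intro emeasure_UN_countable) (auto simp: countable_integer_lattice disj)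
  also have "\<dots> = (\<integral>\<^sup>+u. \<integral>\<^sup>+x. indicator unit_cell x * indicator M (x + u) \<partial>lborel \<partial>count_space ?Z)"
    by (simp add: Xu)
  \<comment> \<open>Tonelli over the countable lattice.\<close>
  also have "\<dots> = (\<integral>\<^sup>+x. \<integral>\<^sup>+u. indicator unit_cell x * indicator M (x + u) \<partial>count_space ?Z \<partial>lborel)"
    by (rule nn_integral_count_space_nn_integral [symmetric]) (simp_all add: countable_integer_lattice)
  also have "\<dots> = (\<integral>\<^sup>+x. indicator unit_cell x *
      emeasure (count_space ?Z) {u \<in> ?Z. x + u \<in> M} \<partial>lborel)"
  proof (intro nn_integral_cong)
    fix x
    have "(\<integral>\<^sup>+u. indicator unit_cell x * indicator M (x + u) \<partial>count_space ?Z)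
        = (\<integral>\<^sup>+u. indicator unit_cell x * indicator {u \<in> ?Z. x + u \<in> M} u \<partial>count_space ?Z)"
      by (intro nn_integral_cong) (auto simp: indicator_def)
    also have "\<dots> = indicator unit_cell x * emeasure (count_space ?Z) {u \<in> ?Z. x + u \<in> M}"
      by (subst nn_integral_cmult_indicator) auto
    finally show "(\<integral>\<^sup>+u. indicator unit_cell x * indicator M (x + u) \<partial>count_space ?Z) = \<dots>" .
  qed
  finally show ?thesis .
qed

text \<open>The integrand of the periodization is at least \<open>m\<close> on the cell. The
  hypothesis asks for a finite \<open>T\<close> because \<open>card\<close> of an infinite set is
  0.\<close>

lemma measure_ge_if_lattice_translates:
  fixes M :: "(real ^ 'n) set"
  assumes M: "M \<in> sets borel" "M \<in> lmeasurable"
    and T: "\<And>x. \<exists>T \<subseteq> integer_lattice. finite T \<and> m \<le> card T \<and> (\<forall>u\<in>T. x + u \<in> M)"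
  shows "real m \<le> measure lebesgue M"
proof -
  have "of_nat m \<le> emeasure (count_space integer_lattice) {u \<in> integer_lattice. x + u \<in> M}" for x
  proof -
    obtain T where T: "T \<subseteq> integer_lattice" "finite T" "m \<le> card T" "\<forall>u\<in>T. x + u \<in> M"
      using T by blast
    have "of_nat m \<le> (of_nat (card T) :: ennreal)"
      using T by simp
    also have "\<dots> = emeasure (count_space integer_lattice) T"
      using T by (simp add: emeasure_count_space)
    also have "\<dots> \<le> emeasure (count_space integer_lattice) {u \<in> integer_lattice. x + u \<in> M}"
      using T by (intro emeasure_mono) auto
    finally show ?thesis .
  qed
  then have "(\<integral>\<^sup>+x. of_nat m * indicator unit_cell x \<partial>(lborel :: (real ^ 'n) measure)) \<le> emeasure lborel M"
    unfolding emeasure_periodization[OF M(1)]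
    by (intro nn_integral_mono) (auto simp: indicator_def)
  then have "of_nat m \<le> emeasure lebesgue M"
    using M(1) by (subst (asm) nn_integral_cmult_indicator) (auto simp: emeasure_unit_cell)
  then show ?thesis
    using M(2) by (simp add: emeasure_eq_measure2 fmeasurableD2 ennreal_of_nat_eq_real_of_nat)
qed

text \<open>The same formula with the integrand bounded above; finiteness is demanded separately,
  again because \<open>card\<close> of an infinite set is 0.\<close>

lemma measure_le_if_lattice_translates:
  fixes M :: "(real ^ 'n) set"
  assumes M: "M \<in> sets borel"
    and T: "\<And>x. finite {u \<in> integer_lattice. x + u \<in> M} \<and> card {u \<in> integer_lattice. x + u \<in> M} \<le> m"
  shows "measure lebesgue M \<le> real m"
proof -
  have "emeasure lborel M \<le> (\<integral>\<^sup>+x. of_nat m * indicator unit_cell x \<partial>(lborel :: (real ^ 'n) measure))"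
    unfolding emeasure_periodization[OF M(1)]
    using T by (intro nn_integral_mono) (auto simp: indicator_def emeasure_count_space)
  also have "\<dots> = of_nat m"
    by (subst nn_integral_cmult_indicator) (auto simp: emeasure_unit_cell)
  finally have "emeasure lebesgue M \<le> ennreal (real m)"
    using M by (simp add: ennreal_of_nat_eq_real_of_nat)
  then show ?thesis
    unfolding measure_def by (metis enn2real_leI of_nat_0_le_iff)
qed

text \<open>Expand \<open>x\<close> in the vectors \<open>z i\<close> and subtract the integer parts
  of the coefficients; the fractional parts remain.\<close>

lemma lattice_parallelepiped_covers:
  fixes z :: "'i \<Rightarrow> real ^ 'n"
  assumes z: "\<And>i. i \<in> I \<Longrightarrow> z i \<in> integer_lattice"
    and fin: "finite I" and inj: "inj_on z I" and span: "span (z ` I) = UNIV"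
  shows "\<exists>u\<in>integer_lattice. \<exists>c. (\<forall>i\<in>I. 0 \<le> c i \<and> c i \<le> 1) \<and> u + x = (\<Sum>i\<in>I. c i *\<^sub>R z i)"
proof -
  have "x \<in> span (z ` I)" using span by simp
  then obtain d where "x = (\<Sum>v\<in>z ` I. d v *\<^sub>R v)"
    using fin by (auto simp: span_finite)
  then have x: "x = (\<Sum>i\<in>I. d (z i) *\<^sub>R z i)"
    by (simp add: sum.reindex[OF inj])
  let ?u = "\<Sum>i\<in>I. real_of_int (- \<lfloor>d (z i)\<rfloor>) *\<^sub>R z i"
  have "?u \<in> integer_lattice"
    by (intro integer_lattice_sum integer_lattice_int_scale z)
  moreover have "?u + x = (\<Sum>i\<in>I. frac (d (z i)) *\<^sub>R z i)"
    by (subst x) (simp add: sum.distrib[symmetric] scaleR_left_distrib[symmetric] frac_def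
        del: scaleR_minus_left)
  moreover have "\<forall>i\<in>I. 0 \<le> frac (d (z i)) \<and> frac (d (z i)) \<le> 1"
    by (simp add: frac_lt_1 less_imp_le)
  ultimately show ?thesis
    by (intro bexI[of _ ?u] exI[of _ "\<lambda>i. frac (d (z i))"] conjI)
qed

subsection \<open>Sweeping a convex body along a chord\<close>

text \<open>The Minkowski sum of \<open>K\<close> and the segment from 0 to \<open>a\<close> times
  \<open>v\<close>, as the image of a product under a continuous linear map, which passes on
  compactness and convexity.\<close>

definition sweep :: "'a::real_vector set \<Rightarrow> real \<Rightarrow> 'a \<Rightarrow> 'a set" where
  "sweep K a v = (\<lambda>(x, s). x + s *\<^sub>R v) ` (K \<times> {0..a})"

lemma sweepI: "x \<in> K \<Longrightarrow> 0 \<le> s \<Longrightarrow> s \<le> a \<Longrightarrow> x + s *\<^sub>R v \<in> sweep K a v"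
  unfolding sweep_def by (rule image_eqI[of _ _ "(x, s)"]) auto

lemma sweepE:
  assumes "p \<in> sweep K a v"
  obtains x s where "x \<in> K" "0 \<le> s" "s \<le> a" "p = x + s *\<^sub>R v"
  using assms by (auto simp: sweep_def)

lemma subset_sweep: "0 \<le> a \<Longrightarrow> K \<subseteq> sweep K a v"
  using sweepI[of _ K 0 a v] by auto

lemma compact_sweep:
  fixes K :: "'a::real_normed_vector set"
  assumes "compact K"
  shows "compact (sweep K a v)"
  unfolding sweep_def
proof (rule compact_continuous_image)
  show "continuous_on (K \<times> {0..a}) (\<lambda>(x, s). x + s *\<^sub>R v)"
    unfolding case_prod_unfold by (intro continuous_intros)
  show "compact (K \<times> {0..a})"
    using assms by (rule compact_Times) simp
qed

lemma convex_sweep: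
  assumes "convex K"
  shows "convex (sweep K a v)"
  unfolding sweep_def
proof (rule convex_linear_image)
  show "linear (\<lambda>(x, s). x + s *\<^sub>R v)"
    by (rule linearI) (auto simp: algebra_simps)
  show "convex (K \<times> {0..a})"
    using assms by (rule convex_Times) simp
qed

text \<open>Adding \<open>t\<close> times \<open>y\<close> to a swept point gives \<open>k\<close>
  plus \<open>t\<close> times a point of the chord from \<open>y\<close> to \<open>x\<close>. Both
  points lie in \<open>K\<close>, so dividing by \<open>1 + t\<close> yields a convex
  combination.\<close>

lemma sweep_chord_subset:
  assumes "convex K" "x \<in> K" "y \<in> K" "0 < t"
  shows "sweep K 1 (t *\<^sub>R (x - y)) \<subseteq> (\<lambda>z. (1 + t) *\<^sub>R z + (- t) *\<^sub>R y) ` K"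
proof
  fix p assume "p \<in> sweep K 1 (t *\<^sub>R (x - y))"
  then obtain k s where k: "k \<in> K" "0 \<le> s" "s \<le> 1" "p = k + s *\<^sub>R (t *\<^sub>R (x - y))"
    by (rule sweepE)
  have "s *\<^sub>R x + (1 - s) *\<^sub>R y \<in> K"
    using assms k by (intro convexD) auto
  then have "(1 / (1 + t)) *\<^sub>R k + (t / (1 + t)) *\<^sub>R (s *\<^sub>R x + (1 - s) *\<^sub>R y) \<in> K"
    using assms k by (intro convexD) (auto simp: field_simps)
  moreover have "p = (1 + t) *\<^sub>R ((1 / (1 + t)) *\<^sub>R k + (t / (1 + t)) *\<^sub>R (s *\<^sub>R x + (1 - s) *\<^sub>R y)) + (- t) *\<^sub>R y"
    using assms(4) by (simp add: k(4) scaleR_right_distrib) (simp add: algebra_simps)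
  ultimately show "p \<in> (\<lambda>z. (1 + t) *\<^sub>R z + (- t) *\<^sub>R y) ` K"
    by blast
qed

text \<open>A point outside \<open>K\<close> is shifted back along \<open>v\<close> close to where it leaves \<open>K\<close>; this makes the
  added volume subadditive in the sweeping length.\<close>

lemma sweep_diff_subset:
  fixes K :: "'a::euclidean_space set"
  assumes K: "compact K" and N: "N > 0"
  shows "sweep K 1 v - K \<subseteq>
    (\<Union>j<N. (+) ((real j / real N) *\<^sub>R v) ` (sweep K 1 ((1 / real N) *\<^sub>R v) - K))"
proof
  fix p assume p: "p \<in> sweep K 1 v - K"
  \<comment> \<open>The times at which the ray from \<open>p\<close> in direction \<open>-v\<close>
    is in \<open>K\<close>. The least one, \<open>s\<close>, is positive since \<open>p\<close> is
    outside \<open>K\<close>.\<close>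
  define T where "T = {s \<in> {0..1}. p - s *\<^sub>R v \<in> K}"
  have "T \<noteq> {}"
    using p by (auto simp: T_def elim!: sweepE)
  moreover have "compact T"
  proof -
    have "T = {0..1} \<inter> (\<lambda>s. p - s *\<^sub>R v) -` K"
      by (auto simp: T_def)
    moreover have "closed ((\<lambda>s. p - s *\<^sub>R v) -` K)"
      using K by (intro closed_vimage) (auto intro!: continuous_intros simp: compact_imp_closed)
    ultimately show ?thesis by (simp add: compact_Int_closed)
  qed
  ultimately obtain s where s: "s \<in> T" and min: "\<And>r. r \<in> T \<Longrightarrow> s \<le> r"
    using compact_attains_inf[of T] by auto
  have "0 < s" "s \<le> 1" and sK: "p - s *\<^sub>R v \<in> K"
    using s p by (auto simp: T_def order.order_iff_strict)
  \<comment> \<open>The largest integer strictly below \<open>s * N\<close>. Ceiling minus one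
    replaces the floor because \<open>j / N\<close> must precede \<open>s\<close> strictly, so that
    \<open>q\<close> is still outside \<open>K\<close>.\<close>
  define j where "j = nat (\<lceil>s * N\<rceil> - 1)"
  have "0 < s * N"
    using \<open>0 < s\<close> N by simp
  then have j: "real j = real_of_int \<lceil>s * N\<rceil> - 1"
    unfolding j_def by (simp add: zero_less_ceiling)
  then have j1: "real j < s * N" "s * N \<le> real j + 1"
    by linarith+
  have "s * N \<le> N"
    using \<open>s \<le> 1\<close> N by (simp add: mult_left_le_one_le)
  with j1 have "j < N" by linarith
  define q where "q = p - (real j / N) *\<^sub>R v"
  have "q \<notin> K"
  proof
    assume "q \<in> K"
    moreover have "real j / N \<le> 1"
      using \<open>j < N\<close> by simp
    ultimately have "s \<le> real j / N"
      by (intro min) (auto simp: T_def q_def)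
    with j1 N show False by (simp add: field_simps)
  qed
  moreover have "q \<in> sweep K 1 ((1 / real N) *\<^sub>R v)"
  proof -
    have "(s * N - real j) * (1 / N) = s - real j / N"
      using N by (simp add: field_simps)
    then have "q = p - s *\<^sub>R v + (s * N - real j) *\<^sub>R ((1 / real N) *\<^sub>R v)"
      by (simp add: q_def scaleR_left_diff_distrib)
    then show ?thesis
      using sweepI[OF sK, of "s * N - real j" 1 "(1 / real N) *\<^sub>R v"] j1 by simp
  qed
  moreover have "p = (real j / N) *\<^sub>R v + q"
    by (simp add: q_def)
  ultimately show "p \<in> (\<Union>j<N. (+) ((real j / real N) *\<^sub>R v) ` (sweep K 1 ((1 / real N) *\<^sub>R v) - K))"
    using \<open>j < N\<close> by blast
qed

text \<open>A single application of \<open>sweep_chord_subset\<close> would only give the factor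
  \<open>(1 + t) ^ n\<close>. Splitting into \<open>N\<close> short sweeps and letting
  \<open>N\<close> grow makes the factor linear in \<open>t\<close>.\<close>

lemma measure_sweep_le:
  fixes K :: "'a::euclidean_space set" and t :: real
  assumes K: "compact K" "convex K" and xy: "x \<in> K" "y \<in> K" and t: "0 < t"
  shows "measure lebesgue (sweep K 1 (t *\<^sub>R (x - y))) \<le> (1 + DIM('a) * t) * measure lebesgue K"
proof -
  let ?n = "DIM('a)" and ?m = "measure lebesgue :: 'a set \<Rightarrow> real"
  define v where "v = t *\<^sub>R (x - y)"
  have step: "?m (sweep K 1 v) \<le> (1 + real N * ((1 + t / N) ^ ?n - 1)) * ?m K" if N: "N > 0" for N :: nat
  proof -
    let ?S = "sweep K 1 ((1 / real N) *\<^sub>R v)"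
    have KS: "K \<subseteq> sweep K 1 w" and mS: "sweep K 1 w \<in> lmeasurable" for w
      using K by (auto intro: lmeasurable_compact compact_sweep simp: subset_sweep[THEN subsetD])
    have mK: "K \<in> lmeasurable" using K by (simp add: lmeasurable_compact)
    have "?S \<subseteq> (\<lambda>z. (1 + t / N) *\<^sub>R z + (- (t / N)) *\<^sub>R y) ` K"
      using sweep_chord_subset[OF K(2) xy, of "t / N"] t N by (simp add: v_def)
    moreover have "(\<lambda>z. (1 + t / N) *\<^sub>R z + (- (t / N)) *\<^sub>R y) ` K \<in> lmeasurable"
      using K by (intro lmeasurable_compact compact_continuous_image) (auto intro!: continuous_intros)
    ultimately have "?m ?S \<le> ?m ((\<lambda>z. (1 + t / N) *\<^sub>R z + (- (t / N)) *\<^sub>R y) ` K)"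
      using mS by (intro measure_mono_fmeasurable) auto
    also have "\<dots> = (1 + t / N) ^ ?n * ?m K"
      using t by (subst measure_lebesgue_affine) simp
    finally have S: "?m ?S \<le> (1 + t / N) ^ ?n * ?m K" .
    have "?m (sweep K 1 v) - ?m K = ?m (sweep K 1 v - K)"
      using KS mS mK by (intro measurable_measure_Diff [symmetric]) auto
    also have "\<dots> \<le> ?m (\<Union>j<N. (+) ((real j / real N) *\<^sub>R v) ` (?S - K))"
      using sweep_diff_subset[OF K(1) N] mS mK
      by (intro measure_mono_fmeasurable)
        (auto intro!: fmeasurable.finite_UN measurable_translation fmeasurable.Diff fmeasurableD)
    also have "\<dots> \<le> (\<Sum>j<N. ?m ((+) ((real j / real N) *\<^sub>R v) ` (?S - K)))"
      using mS mK
      by (intro measure_UNION_le) (auto intro!: measurable_translation fmeasurable.Diff fmeasurableD)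
    also have "\<dots> = real N * (?m ?S - ?m K)"
      using KS mS mK by (simp add: measure_translation measurable_measure_Diff fmeasurableD)
    also have "\<dots> \<le> real N * ((1 + t / N) ^ ?n * ?m K - ?m K)"
      using S by (intro mult_left_mono) auto
    finally show ?thesis by (simp add: algebra_simps)
  qed
  have "(\<lambda>N. 1 + real N * ((1 + t / N) ^ ?n - 1)) \<longlonglongrightarrow> 1 + ?n * t"
  proof -
    \<comment> \<open>The limit is \<open>t\<close> times the derivative of
      \<open>(1 + x) ^ n\<close> at 0, taken along \<open>x = t / N\<close>.\<close>
    have "((\<lambda>x::real. (1 + x) ^ ?n) has_field_derivative ?n) (at 0)"
      by (auto intro!: derivative_eq_intros)
    then have "((\<lambda>h::real. ((1 + h) ^ ?n - 1) / h) \<longlongrightarrow> ?n) (at 0)"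
      by (simp add: DERIV_def)
    moreover have "filterlim (\<lambda>N. t / real N) (at 0) sequentially"
      using t by real_asymp
    ultimately have "(\<lambda>N. ((1 + t / real N) ^ ?n - 1) / (t / real N)) \<longlonglongrightarrow> ?n"
      by (rule filterlim_compose)
    then have "(\<lambda>N. 1 + (((1 + t / real N) ^ ?n - 1) / (t / real N)) * t) \<longlonglongrightarrow> 1 + ?n * t"
      by (intro tendsto_intros)
    then show ?thesis
      using t by (simp add: mult.commute)
  qed
  then have "(\<lambda>N. (1 + real N * ((1 + t / N) ^ ?n - 1)) * ?m K) \<longlonglongrightarrow> (1 + ?n * t) * ?m K"
    by (rule tendsto_mult_right)
  moreover have "\<forall>N\<ge>1. ?m (sweep K 1 v) \<le> (1 + real N * ((1 + t / N) ^ ?n - 1)) * ?m K"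
    by (intro allI impI step) simp
  ultimately have "?m (sweep K 1 v) \<le> (1 + ?n * t) * ?m K"
    by (rule LIMSEQ_le_const[OF _ exI])
  then show ?thesis by (simp add: v_def)
qed

text \<open>Sweep along one edge at a time. Keeping \<open>K\<close> inside \<open>M\<close> is what
  drives the induction: the endpoints \<open>x j\<close> and \<open>y j\<close> of the next chord
  still belong to the enlarged body.\<close>

lemma parallelepiped_sum_body:
  fixes K :: "'a::euclidean_space set" and t :: "'i \<Rightarrow> real"
  assumes K: "compact K" "convex K" and fin: "finite I"
    and xy: "\<And>i. i \<in> I \<Longrightarrow> x i \<in> K \<and> y i \<in> K \<and> 0 < t i \<and> z i = t i *\<^sub>R (x i - y i)"
  shows "\<exists>M. compact M \<and> convex M \<and> K \<subseteq> M \<and>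
    (\<forall>k\<in>K. \<forall>c. (\<forall>i\<in>I. 0 \<le> c i \<and> c i \<le> 1) \<longrightarrow> k + (\<Sum>i\<in>I. c i *\<^sub>R z i) \<in> M) \<and>
    measure lebesgue M \<le> measure lebesgue K * (\<Prod>i\<in>I. 1 + DIM('a) * t i)"
  using fin xy
proof (induction I)
  case empty
  then show ?case using K by auto
next
  case (insert j I)
  then obtain M where M: "compact M" "convex M" "K \<subseteq> M"
    and Mc: "\<And>k c. k \<in> K \<Longrightarrow> (\<forall>i\<in>I. 0 \<le> c i \<and> c i \<le> 1) \<Longrightarrow> k + (\<Sum>i\<in>I. c i *\<^sub>R z i) \<in> M"
    and Mm: "measure lebesgue M \<le> measure lebesgue K * (\<Prod>i\<in>I. 1 + DIM('a) * t i)"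
    by auto
  have j: "x j \<in> M" "y j \<in> M" "0 < t j" "z j = t j *\<^sub>R (x j - y j)"
    using insert.prems M(3) by auto
  have "measure lebesgue (sweep M 1 (z j)) \<le> (1 + DIM('a) * t j) * measure lebesgue M"
    using measure_sweep_le[OF M(1,2) j(1,2,3)] j(4) by simp
  also have "\<dots> \<le> (1 + DIM('a) * t j) * (measure lebesgue K * (\<Prod>i\<in>I. 1 + DIM('a) * t i))"
    using Mm j(3) by (intro mult_left_mono) auto
  finally have "measure lebesgue (sweep M 1 (z j)) \<le> measure lebesgue K * (\<Prod>i\<in>insert j I. 1 + DIM('a) * t i)"
    using insert.hyps by (simp add: mult_ac)
  moreover have "k + (\<Sum>i\<in>insert j I. c i *\<^sub>R z i) \<in> sweep M 1 (z j)"
    if "k \<in> K" "\<forall>i\<in>insert j I. 0 \<le> c i \<and> c i \<le> 1" for k c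
  proof -
    have M: "k + (\<Sum>i\<in>I. c i *\<^sub>R z i) \<in> M" using that by (intro Mc) auto
    have eq: "k + (\<Sum>i\<in>insert j I. c i *\<^sub>R z i) = k + (\<Sum>i\<in>I. c i *\<^sub>R z i) + c j *\<^sub>R z j"
      using insert.hyps by (simp add: add_ac)
    show ?thesis
      unfolding eq using that(2) by (intro sweepI[OF M]) auto
  qed
  moreover have "K \<subseteq> sweep M 1 (z j)"
    using M(3) subset_sweep[of 1 M "z j"] by auto
  ultimately show ?case
    using M by (intro exI[of _ "sweep M 1 (z j)"]) (auto simp: compact_sweep convex_sweep)
qed

subsection \<open>Successive minima\<close>

lemma central_symmetral_body:
  fixes K :: "(real ^ 'n) set"
  assumes "K \<in> convex_bodies"
  shows "compact (central_symmetral K)" and "0 \<in> interior (central_symmetral K)"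
proof -
  have K: "compact K" "interior K \<noteq> {}"
    using assms by (auto simp: convex_bodies_def)
  show "compact (central_symmetral K)"
    unfolding central_symmetral_def using K by (intro compact_scaling compact_differences)
  obtain p e where e: "0 < e" "ball p e \<subseteq> K"
    using K(2) by (metis all_not_in_conv mem_interior)
  have "ball 0 e \<subseteq> central_symmetral K"
  proof
    fix z :: "real ^ 'n" assume "z \<in> ball 0 e"
    then have "p + z \<in> K" "p - z \<in> K"
      using e(2) by (auto simp: dist_norm subset_iff)
    moreover have "z = (1 / 2) *\<^sub>R ((p + z) - (p - z))"
      by (simp add: scaleR_2[symmetric])
    ultimately show "z \<in> central_symmetral K"
      unfolding central_symmetral_def by blast
  qed
  then show "0 \<in> interior (central_symmetral K)"
    using e(1) by (auto simp: mem_interior)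
qed

text \<open>The minimum is attained because the admissible factors up to some bound \<open>R\<close>
  form a nonempty compact set: only finitely many lattice points matter there, and each imposes a
  closed condition.\<close>

lemma symmetric_successive_minimum_least:
  fixes S :: "(real ^ 'n) set"
  assumes S: "compact S" "0 \<in> interior S" and i: "1 \<le> i" "i \<le> CARD('n)"
  shows "\<exists>c. (0 < c \<and> i \<le> dim ((\<lambda>x. c *\<^sub>R x) ` S \<inter> integer_lattice)) \<and>
    (\<forall>d. 0 < d \<and> i \<le> dim ((\<lambda>x. d *\<^sub>R x) ` S \<inter> integer_lattice) \<longrightarrow> c \<le> d)"
proof -
  define A where "A c = (\<lambda>x. c *\<^sub>R x) ` S \<inter> integer_lattice" for c
  obtain e where e: "0 < e" "ball 0 e \<subseteq> S"
    using S(2) by (auto simp: mem_interior)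
  \<comment> \<open>With this factor every unit vector, divided by \<open>R\<close>, has norm
    \<open>e / 2\<close> and so lies in the ball inside \<open>S\<close>.\<close>
  define R where "R = 2 / e"
  have "R > 0" using e by (simp add: R_def)
  have "(Basis :: (real ^ 'n) set) \<subseteq> A R"
  proof
    fix b :: "real ^ 'n" assume b: "b \<in> Basis"
    have "(1 / R) *\<^sub>R b \<in> S"
      using e b by (intro subsetD[OF e(2)]) (simp add: R_def)
    then have "R *\<^sub>R ((1 / R) *\<^sub>R b) \<in> (\<lambda>x. R *\<^sub>R x) ` S"
      by blast
    moreover have "b \<in> integer_lattice"
      using b by (auto simp: Basis_vec_def integer_lattice_def axis_def)
    ultimately show "b \<in> A R"
      using \<open>R > 0\<close> by (simp add: A_def)
  qed
  then have "dim (Basis :: (real ^ 'n) set) \<le> dim (A R)"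
    by (rule dim_subset)
  then have R: "i \<le> dim (A R)"
    using i by (simp add: dim_eq_card_independent independent_Basis)
  \<comment> \<open>All lattice points met by dilates with factor at most \<open>R\<close>; a
    bounded, hence finite, set.\<close>
  define F where "F = (\<lambda>(c, x). c *\<^sub>R x) ` ({0..R} \<times> S) \<inter> integer_lattice"
  have cont: "continuous_on U (\<lambda>(c :: real, x :: real ^ 'n). c *\<^sub>R x)" for U
    unfolding case_prod_unfold by (intro continuous_intros)
  have "compact ({0..R} \<times> S)"
    using S(1) by (intro compact_Times) auto
  then have "compact ((\<lambda>(c, x). c *\<^sub>R x) ` ({0..R} \<times> S))"
    by (intro compact_continuous_image cont)
  then have "finite F"
    unfolding F_def by (intro finite_bounded_Int_integer_lattice compact_imp_bounded)
  \<comment> \<open>The factors whose dilate contains \<open>z\<close>: a projection of a compact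
    set, hence closed.\<close>
  define T where "T z = {c \<in> {0..R}. z \<in> (\<lambda>x. c *\<^sub>R x) ` S}" for z
  have "closed (T z)" for z
  proof -
    have "T z = fst ` (({0..R} \<times> S) \<inter> (\<lambda>(c, x). c *\<^sub>R x) -` {z})"
      by (force simp: T_def)
    moreover have "compact (({0..R} \<times> S) \<inter> (\<lambda>(c, x). c *\<^sub>R x) -` {z})"
      using \<open>compact ({0..R} \<times> S)\<close> by (intro compact_Int_closed closed_vimage cont) auto
    ultimately show ?thesis
      by (simp only: compact_imp_closed compact_continuous_image continuous_on_fst continuous_on_id)
  qed
  then have "closed ({0..R} \<inter> (\<Inter>z\<in>B. T z))" for B
    by (intro closed_Int closed_INT) auto
  then have "closed (\<Union>B\<in>{B \<in> Pow F. i \<le> dim B}. {0..R} \<inter> (\<Inter>z\<in>B. T z))"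
    using \<open>finite F\<close> by (intro closed_UN) auto
  \<comment> \<open>Dimension at least \<open>i\<close> is witnessed by some subset \<open>B\<close>
    of the finite set \<open>F\<close>, which turns the condition into a finite union of closed
    sets.\<close>
  moreover have "{c \<in> {0..R}. i \<le> dim (A c)} = (\<Union>B\<in>{B \<in> Pow F. i \<le> dim B}. {0..R} \<inter> (\<Inter>z\<in>B. T z))"
    (is "?X = ?Y")
  proof
    show "?X \<subseteq> ?Y"
    proof
      fix c assume c: "c \<in> ?X"
      then have "A c \<subseteq> F" "\<forall>z\<in>A c. c \<in> T z"
        by (force simp: A_def F_def T_def)+
      with c show "c \<in> ?Y" by auto
    qed
    show "?Y \<subseteq> ?X"
    proof
      fix c assume "c \<in> ?Y"
      then obtain B where B: "B \<subseteq> F" "i \<le> dim B" "c \<in> {0..R}" "\<forall>z\<in>B. c \<in> T z"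
        by auto
      then have "B \<subseteq> A c"
        by (auto simp: A_def F_def T_def)
      then have "i \<le> dim (A c)"
        using B(2) dim_subset[of B "A c"] by linarith
      with B(3) show "c \<in> ?X" by simp
    qed
  qed
  ultimately have "closed ?X" by simp
  moreover have "bounded ?X"
    by (rule bounded_subset[of "{0..R}"]) auto
  ultimately have "compact ?X"
    by (simp add: compact_eq_bounded_closed)
  moreover have RX: "R \<in> ?X"
    using R \<open>R > 0\<close> by simp
  ultimately obtain c where c: "c \<in> ?X" and min: "\<And>d. d \<in> ?X \<Longrightarrow> c \<le> d"
    using compact_attains_inf[of ?X] by auto
  have "c \<noteq> 0"
  proof
    assume "c = 0"
    then have "A c \<subseteq> {0}" by (auto simp: A_def)
    then have "dim (A c) = 0" by simp
    with c i show False by simp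
  qed
  moreover have "c \<le> d" if "0 < d" "i \<le> dim (A d)" for d
    using that min[of d] min[OF RX] by (cases "d \<le> R") auto
  ultimately show ?thesis
    using c by (intro exI[of _ c]) (auto simp: A_def)
qed

text \<open>Attainment supplies the lattice vectors; minimality gives monotonicity in
  \<open>i\<close>.\<close>

lemma successive_minimum_least:
  fixes K :: "(real ^ 'n) set"
  assumes K: "K \<in> convex_bodies" and i: "1 \<le> i" "i \<le> CARD('n)"
  shows "0 < successive_minimum K i"
    and "i \<le> dim ((\<lambda>x. successive_minimum K i *\<^sub>R x) ` central_symmetral K \<inter> integer_lattice)"
    and "0 < d \<Longrightarrow> i \<le> dim ((\<lambda>x. d *\<^sub>R x) ` central_symmetral K \<inter> integer_lattice) \<Longrightarrow>
      successive_minimum K i \<le> d"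
proof -
  define P where "P c \<longleftrightarrow> 0 < c \<and> i \<le> dim ((\<lambda>x. c *\<^sub>R x) ` central_symmetral K \<inter> integer_lattice)" for c
  obtain c where c: "P c" "\<And>d. P d \<Longrightarrow> c \<le> d"
    using symmetric_successive_minimum_least[OF central_symmetral_body[OF K] i] by (auto simp: P_def)
  have "successive_minimum K i = Least P"
    unfolding successive_minimum_def symmetric_successive_minimum_def P_def ..
  also have "\<dots> = c"
    using c by (intro Least_equality)
  finally have eq: "successive_minimum K i = c" .
  show "0 < successive_minimum K i"
    and "i \<le> dim ((\<lambda>x. successive_minimum K i *\<^sub>R x) ` central_symmetral K \<inter> integer_lattice)"
    using c(1) unfolding eq P_def by auto
  show "successive_minimum K i \<le> d"
    if "0 < d" "i \<le> dim ((\<lambda>x. d *\<^sub>R x) ` central_symmetral K \<inter> integer_lattice)"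
    using c(2)[of d] that unfolding eq P_def by auto
qed

text \<open>Greedy choice: \<open>m\<close> vectors span dimension at most \<open>m\<close>, so a
  set of dimension at least \<open>m + 1\<close> has a point outside their span.\<close>

lemma independent_transversal:
  fixes A :: "nat \<Rightarrow> 'a::euclidean_space set"
  assumes "\<And>i. i \<in> {1..m} \<Longrightarrow> i \<le> dim (A i)"
  shows "\<exists>z. (\<forall>i\<in>{1..m}. z i \<in> A i) \<and> inj_on z {1..m} \<and> independent (z ` {1..m})"
  using assms
proof (induction m)
  case 0
  then show ?case by (auto simp: independent_empty)
next
  case (Suc m)
  then obtain z where z: "\<forall>i\<in>{1..m}. z i \<in> A i" "inj_on z {1..m}" "independent (z ` {1..m})"
    by auto
  have "\<not> A (Suc m) \<subseteq> span (z ` {1..m})"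
  proof
    assume "A (Suc m) \<subseteq> span (z ` {1..m})"
    then have "dim (A (Suc m)) \<le> dim (z ` {1..m})"
      by (metis dim_span dim_subset)
    also have "\<dots> \<le> card {1..m}"
      by (meson card_image_le dim_le_card' finite_atLeastAtMost finite_imageI order_trans)
    finally show False using Suc.prems[of "Suc m"] by simp
  qed
  then obtain w where w: "w \<in> A (Suc m)" "w \<notin> span (z ` {1..m})" by blast
  let ?z = "z(Suc m := w)"
  have set: "{1..Suc m} = insert (Suc m) {1..m}" by auto
  have im: "?z ` {1..m} = z ` {1..m}" by auto
  have w_new: "w \<notin> z ` {1..m}" using w(2) span_base[of w "z ` {1..m}"] by argo
  have "inj_on ?z {1..m}"
    by (rule inj_on_fun_updI[OF z(2) w_new])
  then have "inj_on ?z {1..Suc m}"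
    unfolding set inj_on_insert using w_new by (simp add: fun_upd_image)
  moreover have "independent (?z ` {1..Suc m})"
    unfolding set image_insert im using z(3) w(2) by (simp add: independent_insert)
  moreover have "\<forall>i\<in>{1..Suc m}. ?z i \<in> A i"
    using z(1) w(1) by (auto simp: le_Suc_eq)
  ultimately show ?case by blast
qed

text \<open>Apply the transversal to the lattice points of the dilated central symmetrals. The
  factor 1/2 in \<open>central_symmetral\<close> is the source of the halved minima.\<close>

lemma successive_minimum_chords:
  fixes K :: "(real ^ 'n) set"
  assumes K: "K \<in> convex_bodies"
  shows "\<exists>z x y. inj_on z {1..CARD('n)} \<and> span (z ` {1..CARD('n)}) = UNIV \<and>
    (\<forall>i\<in>{1..CARD('n)}. z i \<in> integer_lattice \<and> x i \<in> K \<and> y i \<in> K \<and>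
      z i = (successive_minimum K i / 2) *\<^sub>R (x i - y i))"
proof -
  let ?I = "{1..CARD('n)}"
  let ?A = "\<lambda>i. (\<lambda>x. successive_minimum K i *\<^sub>R x) ` central_symmetral K \<inter> integer_lattice"
  obtain z where z: "\<forall>i\<in>?I. z i \<in> ?A i" "inj_on z ?I" "independent (z ` ?I)"
    using independent_transversal[of "CARD('n)" ?A] successive_minimum_least(2)[OF K] by auto
  have "card (z ` ?I) = DIM(real ^ 'n)"
    using z(2) by (simp add: card_image)
  then have "span (z ` ?I) = UNIV"
    using card_ge_dim_independent[of "z ` ?I" UNIV] z(3) by auto
  moreover have "\<forall>i\<in>?I. \<exists>x y. x \<in> K \<and> y \<in> K \<and> z i = (successive_minimum K i / 2) *\<^sub>R (x - y)"
  proof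
    fix i assume "i \<in> ?I"
    with z(1) show "\<exists>x y. x \<in> K \<and> y \<in> K \<and> z i = (successive_minimum K i / 2) *\<^sub>R (x - y)"
      by (fastforce simp: central_symmetral_def)
  qed
  then obtain x y where "\<forall>i\<in>?I. x i \<in> K \<and> y i \<in> K \<and> z i = (successive_minimum K i / 2) *\<^sub>R (x i - y i)"
    by metis
  ultimately show ?thesis using z by blast
qed

subsection \<open>The two bounds\<close>

text \<open>Move \<open>p\<close> by a lattice vector \<open>u\<close> into the parallelepiped; then
  adding any lattice point of \<open>K\<close> lands in \<open>M\<close>. So every coset has at
  least \<open>lattice_count K\<close> points in \<open>M\<close>.\<close>

lemma lattice_count_le:
  fixes K :: "(real ^ 'n) set" and t :: "'i \<Rightarrow> real"
  assumes K: "compact K" "convex K" and span: "inj_on z I" "span (z ` I) = UNIV" and fin: "finite I"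
    and z: "\<And>i. i \<in> I \<Longrightarrow> z i \<in> integer_lattice"
    and xy: "\<And>i. i \<in> I \<Longrightarrow> x i \<in> K \<and> y i \<in> K \<and> 0 < t i \<and> z i = t i *\<^sub>R (x i - y i)"
  shows "real (lattice_count K) \<le> measure lebesgue K * (\<Prod>i\<in>I. 1 + CARD('n) * t i)"
proof -
  obtain M where M: "compact M"
    and Mc: "\<And>k c. k \<in> K \<Longrightarrow> (\<forall>i\<in>I. 0 \<le> c i \<and> c i \<le> 1) \<Longrightarrow> k + (\<Sum>i\<in>I. c i *\<^sub>R z i) \<in> M"
    and Mm: "measure lebesgue M \<le> measure lebesgue K * (\<Prod>i\<in>I. 1 + CARD('n) * t i)"
    using parallelepiped_sum_body[OF K fin, where x = x and y = y and t = t and z = z, OF xy] by auto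
  have "real (lattice_count K) \<le> measure lebesgue M"
  proof (rule measure_ge_if_lattice_translates)
    show "M \<in> sets borel" "M \<in> lmeasurable"
      using M by (auto simp: borel_compact lmeasurable_compact)
    fix p :: "real ^ 'n"
    obtain u c where u: "u \<in> integer_lattice" "\<forall>i\<in>I. 0 \<le> c i \<and> c i \<le> 1"
      "u + p = (\<Sum>i\<in>I. c i *\<^sub>R z i)"
      using lattice_parallelepiped_covers[where z = z, OF z fin span] by blast
    let ?T = "(+) u ` (K \<inter> integer_lattice)"
    have "finite ?T"
      using K(1) by (intro finite_imageI finite_bounded_Int_integer_lattice compact_imp_bounded)
    moreover have "?T \<subseteq> integer_lattice"
      using u(1) by (auto intro: integer_lattice_add)
    moreover have "card ?T = lattice_count K"
      by (simp add: lattice_count_def card_image)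
    moreover have "\<forall>w\<in>?T. p + w \<in> M"
    proof
      fix w assume "w \<in> ?T"
      then obtain k where k: "k \<in> K" "w = u + k" by auto
      have "k + (u + p) \<in> M"
        unfolding u(3) by (rule Mc[OF k(1) u(2)])
      then show "p + w \<in> M" by (simp add: k(2) add_ac)
    qed
    ultimately show "\<exists>T\<subseteq>integer_lattice. finite T \<and> lattice_count K \<le> card T \<and> (\<forall>w\<in>T. p + w \<in> M)"
      by (intro exI[of _ ?T] conjI) simp_all
  qed
  with Mm show ?thesis by linarith
qed

text \<open>A shrunken copy \<open>M\<close> of the interior is placed so that adding the
  parallelepiped stays in the interior. A lattice shift then injects the points of \<open>M\<close>
  in any coset into the lattice points of the interior.\<close>

lemma lattice_count_interior_ge:
  fixes K :: "(real ^ 'n) set" and t :: "'i \<Rightarrow> real"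
  assumes K: "compact K" "convex K" and span: "inj_on z I" "span (z ` I) = UNIV" and fin: "finite I"
    and z: "\<And>i. i \<in> I \<Longrightarrow> z i \<in> integer_lattice"
    and xy: "\<And>i. i \<in> I \<Longrightarrow> x i \<in> K \<and> y i \<in> K \<and> 0 < t i \<and> z i = t i *\<^sub>R (x i - y i)"
    and I: "I \<noteq> {}" and s: "sum t I < 1"
  shows "(1 - sum t I) ^ CARD('n) * measure lebesgue K \<le> real (lattice_count (interior K))"
proof -
  let ?s = "sum t I"
  have s0: "0 < ?s" using xy fin I by (intro sum_pos) auto
  \<comment> \<open>This offset turns each \<open>c i\<close> times \<open>z i\<close> into
    \<open>t i\<close> times a point \<open>w i\<close> of the chord from \<open>y i\<close> to
    \<open>x i\<close>.\<close>
  define q where "q = (\<Sum>i\<in>I. t i *\<^sub>R y i)"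
  define M where "M = (\<lambda>k. (1 - ?s) *\<^sub>R k + q) ` interior K"
  have Mc: "p + (\<Sum>i\<in>I. c i *\<^sub>R z i) \<in> interior K" if p: "p \<in> M" and c: "\<forall>i\<in>I. 0 \<le> c i \<and> c i \<le> 1" for p c
  proof -
    obtain k where k: "k \<in> interior K" "p = (1 - ?s) *\<^sub>R k + q"
      using p by (auto simp: M_def)
    define w where "w i = c i *\<^sub>R x i + (1 - c i) *\<^sub>R y i" for i
    define W where "W = (\<Sum>i\<in>I. (t i / ?s) *\<^sub>R w i)"
    have "w i \<in> K" if "i \<in> I" for i
      unfolding w_def using xy[OF that] c that K(2) by (intro convexD) auto
    then have "W \<in> K"
      unfolding W_def using xy s0 fin K(2)
      by (intro convex_sum) (auto simp: sum_divide_distrib[symmetric] less_imp_le)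
    \<comment> \<open>The point equals \<open>(1 - ?s)\<close> times the interior point
      \<open>k\<close> plus \<open>?s\<close> times \<open>W\<close> in \<open>K\<close>; it is
      interior because \<open>?s < 1\<close>.\<close>
    then have "W - (1 - ?s) *\<^sub>R (W - k) \<in> interior K"
      using K k s s0 by (intro mem_interior_convex_shrink) auto
    moreover have "q + (\<Sum>i\<in>I. c i *\<^sub>R z i) = (\<Sum>i\<in>I. t i *\<^sub>R w i)"
      unfolding q_def sum.distrib[symmetric]
    proof (intro sum.cong refl)
      fix i assume "i \<in> I"
      then have zi: "z i = t i *\<^sub>R (x i - y i)" using xy by blast
      show "t i *\<^sub>R y i + c i *\<^sub>R z i = t i *\<^sub>R w i"
        unfolding zi w_def by (simp add: algebra_simps)
    qed
    moreover have "(\<Sum>i\<in>I. t i *\<^sub>R w i) = ?s *\<^sub>R W"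
      using s0 by (simp add: W_def scaleR_sum_right)
    ultimately have "(1 - ?s) *\<^sub>R k + (q + (\<Sum>i\<in>I. c i *\<^sub>R z i)) \<in> interior K"
      by (simp add: algebra_simps)
    then show ?thesis by (simp add: k(2) add.assoc)
  qed
  have fin_int: "finite (interior K \<inter> integer_lattice)"
    using K(1) by (intro finite_bounded_Int_integer_lattice bounded_interior compact_imp_bounded)
  have "measure lebesgue M \<le> real (lattice_count (interior K))"
  proof (rule measure_le_if_lattice_translates)
    have "open M"
      using open_affinity[of "interior K" "1 - ?s" q] s by (simp add: M_def add.commute)
    then show "M \<in> sets borel" by simp
    fix p :: "real ^ 'n"
    \<comment> \<open>The covering is applied to \<open>-p\<close>: since \<open>v - p\<close> is in
      the parallelepiped, \<open>v + u\<close> is the point \<open>p + u\<close> of \<open>M\<close>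
      plus a point of the parallelepiped.\<close>
    obtain v c where v: "v \<in> integer_lattice" "\<forall>i\<in>I. 0 \<le> c i \<and> c i \<le> 1"
      "v + (- p) = (\<Sum>i\<in>I. c i *\<^sub>R z i)"
      using lattice_parallelepiped_covers[where z = z, OF z fin span] by blast
    let ?U = "{u \<in> integer_lattice. p + u \<in> M}"
    have "(+) v ` ?U \<subseteq> interior K \<inter> integer_lattice"
    proof (clarify, intro IntI)
      fix u assume u: "u \<in> integer_lattice" "p + u \<in> M"
      then show "v + u \<in> integer_lattice" using v by (simp add: integer_lattice_add)
      have "(p + u) + (v + (- p)) \<in> interior K"
        unfolding v(3) using Mc[OF u(2) v(2)] .
      then show "v + u \<in> interior K" by (simp add: algebra_simps)
    qed
    then show "finite ?U \<and> card ?U \<le> lattice_count (interior K)"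
      unfolding lattice_count_def
      by (metis (no_types, lifting) fin_int card_image card_mono finite_imageD finite_subset inj_on_add)
  qed
  moreover have "measure lebesgue M = (1 - ?s) ^ CARD('n) * measure lebesgue (interior K)"
    using s unfolding M_def by (subst measure_lebesgue_affine) simp
  moreover have "measure lebesgue (interior K) = measure lebesgue K"
    using K by (intro measure_interior negligible_convex_frontier compact_imp_bounded)
  ultimately show ?thesis by simp
qed

text \<open>AM-GM with the root removed by taking powers; a vanishing product is treated apart in
  rewriting with \<open>powr\<close>.\<close>

lemma prod_le_mean_power:
  fixes f :: "'a \<Rightarrow> real"
  assumes "finite I" "I \<noteq> {}" "\<And>i. i \<in> I \<Longrightarrow> 0 \<le> f i"
  shows "(\<Prod>i\<in>I. f i) \<le> (\<Sum>i\<in>I. f i / card I) ^ card I"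
proof -
  have c: "card I > 0" using assms by (simp add: card_gt_0_iff)
  have "0 \<le> (\<Prod>i\<in>I. f i)" using assms(3) by (intro prod_nonneg) auto
  then have "(\<Prod>i\<in>I. f i) = ((\<Prod>i\<in>I. f i) powr (1 / card I)) ^ card I"
    using c by (cases "(\<Prod>i\<in>I. f i) = 0") (auto simp: powr_powr simp flip: powr_realpow)
  also have "\<dots> \<le> (\<Sum>i\<in>I. f i / card I) ^ card I"
    using arith_geom_mean[OF assms] by (intro power_mono) auto
  finally show ?thesis .
qed

theorem theorem1p1:
  fixes K :: "(real ^ 'n) set"
  assumes "K \<in> convex_bodies"
  shows "real (lattice_count K) \<le>
           measure lebesgue K *
             (\<Prod>i = 1..CARD('n). 1 + real CARD('n) * successive_minimum K i / 2)
       \<and> (successive_minimum K CARD('n) \<le> 2 / real CARD('n) \<longrightarrow>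
           real (lattice_count (interior K)) \<ge>
             measure lebesgue K *
               (\<Prod>i = 1..CARD('n). 1 - real CARD('n) * successive_minimum K i / 2))"
proof -
  let ?n = "CARD('n)"
  let ?I = "{1..?n}"
  define t where "t i = successive_minimum K i / 2" for i
  have K: "compact K" "convex K"
    using assms by (auto simp: convex_bodies_def)
  have n: "0 < ?n" by simp
  obtain z x y where z: "inj_on z ?I" "span (z ` ?I) = UNIV" "\<And>i. i \<in> ?I \<Longrightarrow> z i \<in> integer_lattice"
    and xy: "\<And>i. i \<in> ?I \<Longrightarrow> x i \<in> K \<and> y i \<in> K \<and> 0 < t i \<and> z i = t i *\<^sub>R (x i - y i)"
    using successive_minimum_chords[OF assms] successive_minimum_least(1)[OF assms]
    unfolding t_def by (metis (no_types, lifting) atLeastAtMost_iff half_gt_zero)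
  have upper: "real (lattice_count K) \<le> measure lebesgue K * (\<Prod>i\<in>?I. 1 + ?n * t i)"
    using lattice_count_le[where z = z and x = x and y = y and t = t, OF K z(1,2) _ z(3) xy] by simp
  have lower: "measure lebesgue K * (\<Prod>i\<in>?I. 1 - ?n * t i) \<le> real (lattice_count (interior K))"
    if le: "successive_minimum K ?n \<le> 2 / ?n"
  proof -
    have t_le: "t i \<le> 1 / ?n" if i: "i \<in> ?I" for i
    proof -
      \<comment> \<open>A dilate with lattice dimension at least \<open>?n\<close> has lattice
        dimension at least \<open>i\<close>, so the last minimum is admissible for
        \<open>i\<close>.\<close>
      have "successive_minimum K i \<le> successive_minimum K ?n"
        using i n successive_minimum_least(1,2)[OF assms, of ?n]
        by (intro successive_minimum_least(3)[OF assms]) auto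
      with le show ?thesis by (simp add: t_def)
    qed
    have nonneg: "0 \<le> 1 - ?n * t i" if "i \<in> ?I" for i
      using t_le[OF that] n by (simp add: field_simps)
    have "(\<Prod>i\<in>?I. 1 - ?n * t i) \<le> (\<Sum>i\<in>?I. (1 - ?n * t i) / card ?I) ^ card ?I"
      using n nonneg by (intro prod_le_mean_power) auto
    also have "(\<Sum>i\<in>?I. (1 - ?n * t i) / card ?I) = 1 - sum t ?I"
      by (simp add: diff_divide_distrib sum_subtractf)
    finally have amgm: "(\<Prod>i\<in>?I. 1 - ?n * t i) \<le> (1 - sum t ?I) ^ ?n"
      by simp
    have "sum t ?I \<le> 1"
      using sum_mono[of ?I t "\<lambda>_. 1 / ?n", OF t_le] by simp
    \<comment> \<open>When the sum is 1 the shrunken body degenerates to a point, but then AM-GM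
      already makes the claimed lower bound nonpositive.\<close>
    then consider "sum t ?I = 1" | "sum t ?I < 1" by linarith
    then show ?thesis
    proof cases
      case 1
      with amgm have "(\<Prod>i\<in>?I. 1 - ?n * t i) \<le> 0" by (simp add: zero_power)
      then have "measure lebesgue K * (\<Prod>i\<in>?I. 1 - ?n * t i) \<le> 0"
        by (rule mult_nonneg_nonpos[OF measure_nonneg])
      then show ?thesis by (rule order_trans) simp
    next
      case 2
      have "measure lebesgue K * (\<Prod>i\<in>?I. 1 - ?n * t i) \<le> measure lebesgue K * (1 - sum t ?I) ^ ?n"
        using amgm by (intro mult_left_mono) auto
      also have "\<dots> \<le> real (lattice_count (interior K))"
        using lattice_count_interior_ge[where z = z and x = x and y = y and t = t, OF K z(1,2) _ z(3) xy _ 2] n by (simp add: mult.commute)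
      finally show ?thesis .
    qed
  qed
  show ?thesis
    using upper lower by (simp add: t_def)
qed

end
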